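(* Let $s_0=\sigma_0+it_0\in\mathbb{C}$ with $\sigma_0>1$, and let $\sigma>1$ be fixed. For $s=\sigma+it$ with $t\geq 2$, $$\int_{2}^{T}|\zeta_2(s_0,\sigma+it)|^2\,dt=\zeta_2^{[2]}(s_0,2\sigma)\,T+O(1)\qquad (T\to\infty).$$
   Context: The Euler double zeta-function is $$\zeta_2(s_1,s_2)=\sum_{m=1}^\infty\frac{1}{m^{s_1}}\sum_{n=1}^\infty\frac{1}{(m+n)^{s_2}}=\sum_{k=2}^\infty\Big(\sum_{m=1}^{k-1}\frac{1}{m^{s_1}}\Big)\frac{1}{k^{s_2}},$$ absolutely convergent for $\Re s_2>1$, $\Re(s_1+s_2)>2$, and continued meromorphically to $\mathbb{C}^2$ (singularities on $s_2=1$ and $s_1+s_2=2,1,0,-2,-4,\dots$). Also $$\zeta_2^{[2]}(s_1,s_2)=\sum_{k=2}^\infty\Big|\sum_{m=1}^{k-1}\frac{1}{m^{s_1}}\Big|^2\frac{1}{k^{s_2}},$$ convergent when $\Re s_1\ge1,\Re s_2>1$, or when $\Re s_1<1$ and $2\Re s_1+\Re s_2>3$. The implied constant in $O$ may depend on $s_0$ and $\sigma$. *)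

theory Defs
  imports "HOL-Analysis.Analysis" "HOL-Library.Landau_Symbols"
begin

text \<open>
  The Euler double zeta-function, given by its defining double series. This is the intended
  function only where the series converges absolutely, that is for \<open>Re s2 > 1\<close> and
  \<open>Re (s1 + s2) > 2\<close>; the meromorphic continuation is not covered.
\<close>
definition euler_double_zeta :: "complex \<Rightarrow> complex \<Rightarrow> complex" where
  "euler_double_zeta s1 s2 =
     (\<Sum>\<^sub>\<infinity>m\<in>{1::nat..}. 1 / of_nat m powr s1 *
        (\<Sum>\<^sub>\<infinity>n\<in>{1::nat..}. 1 / of_nat (m + n) powr s2))"

definition euler_double_zeta_sq :: "complex \<Rightarrow> complex \<Rightarrow> complex" where
  "euler_double_zeta_sq s1 s2 =
     (\<Sum>\<^sub>\<infinity>k\<in>{2::nat..}.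
        of_real ((cmod (\<Sum>m=1..k-1. 1 / of_nat m powr s1))\<^sup>2) * (1 / of_nat k powr s2))"

end

theory Submission
  imports Defs
begin

text \<open>
  Grouping by \<open>k = m + n\<close> turns \<open>\<zeta>\<^sub>2(s\<^sub>0, s)\<close> into a Dirichlet series
  \<open>\<Sum>a\<^sub>k k\<^sup>-\<^sup>s\<close> whose coefficients are bounded because \<open>Re s\<^sub>0 > 1\<close>. Squaring and integrating,
  the diagonal contributes the main term, while a pair \<open>k < l\<close> contributes at most a constant times
  \<open>(k l)\<^sup>-\<^sup>\<sigma> / ln (l / k)\<close>. As \<open>ln (l / k) \<ge> (l - k) / l\<close> and \<open>l powr (1 - \<sigma>) \<le> (l - k) powr (1 - \<sigma>)\<close>,
  this is at most \<open>k\<^sup>-\<^sup>\<sigma> (l - k)\<^sup>-\<^sup>\<sigma>\<close>, so that the off-diagonal terms are dominated by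
  \<open>\<zeta>(\<sigma>)\<^sup>2\<close> independently of \<open>T\<close>. The bound is proved for the partial sums and passes to the limit
  by uniform convergence.
\<close>

section \<open>Mean squares of finite exponential sums\<close>

text \<open>The antiderivative \<open>cis (c * t) / (\<i> * c)\<close> has modulus
  \<open>1 / \<bar>c\<bar>\<close> at both endpoints, so the bound does not grow with the interval.
  This is the source of the bounded error term.\<close>

lemma norm_integral_cis_le:
  fixes a b c :: real
  assumes "a \<le> b" "c \<noteq> 0"
  obtains I where "((\<lambda>t. cis (c * t)) has_integral I) {a..b}" "norm I \<le> 2 / \<bar>c\<bar>"
proof
  let ?F = "\<lambda>t. cis (c * t) / (\<i> * of_real c)"
  show "((\<lambda>t. cis (c * t)) has_integral (?F b - ?F a)) {a..b}"
  proof (rule fundamental_theorem_of_calculus[OF assms(1)])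
    fix x assume "x \<in> {a..b}"
    \<comment> \<open>The derivative is taken in a complex variable and then restricted to the real
      line.\<close>
    have "((\<lambda>z. exp (\<i> * of_real c * z) / (\<i> * of_real c)) has_field_derivative
             exp (\<i> * of_real c * of_real x)) (at (of_real x))"
      using assms(2) by (auto intro!: derivative_eq_intros)
    from has_vector_derivative_real_field[OF this]
    show "(?F has_vector_derivative cis (c * x)) (at x within {a..b})"
      by (simp add: cis_conv_exp mult.assoc has_vector_derivative_at_within)
  qed
  have "norm (?F b - ?F a) \<le> norm (?F b) + norm (?F a)"
    by (rule norm_triangle_ineq4)
  also have "\<dots> = 2 / \<bar>c\<bar>"
    by (simp add: norm_divide norm_mult)
  finally show "norm (?F b - ?F a) \<le> 2 / \<bar>c\<bar>" .
qed

text \<open>The diagonal terms of the double sum on the right vanish because \<open>x / 0 = 0\<close>.\<close>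

lemma mean_square_exponential_sum:
  fixes c :: "'a \<Rightarrow> complex" and \<mu> :: "'a \<Rightarrow> real"
  assumes "finite K" "inj_on \<mu> K" "a \<le> b"
  shows "\<bar>integral {a..b} (\<lambda>t. (cmod (\<Sum>k\<in>K. c k * cis (\<mu> k * t)))\<^sup>2)
            - (b - a) * (\<Sum>k\<in>K. (cmod (c k))\<^sup>2)\<bar>
         \<le> (\<Sum>k\<in>K. \<Sum>l\<in>K. cmod (c k) * cmod (c l) * (2 / \<bar>\<mu> k - \<mu> l\<bar>))"
    (is "\<bar>integral _ ?f - ?D\<bar> \<le> ?B")
proof -
  have "\<exists>I. ((\<lambda>t. cis ((\<mu> k - \<mu> l) * t)) has_integral I) {a..b} \<and>
          (if k = l then I = of_real (b - a) else norm I \<le> 2 / \<bar>\<mu> k - \<mu> l\<bar>)"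
    if "k \<in> K" "l \<in> K" for k l
  proof (cases "k = l")
    case True
    then show ?thesis
      using has_integral_const_real[of "1::complex" a b] assms(3)
      by (auto simp: scaleR_conv_of_real)
  next
    case False
    with that assms(2) have "\<mu> k - \<mu> l \<noteq> 0"
      by (auto dest: inj_onD)
    from norm_integral_cis_le[OF assms(3) this] False show ?thesis
      by metis
  qed
  then obtain I where
    I: "((\<lambda>t. cis ((\<mu> k - \<mu> l) * t)) has_integral I k l) {a..b}"
    and I': "if k = l then I k l = of_real (b - a) else norm (I k l) \<le> 2 / \<bar>\<mu> k - \<mu> l\<bar>"
    if "k \<in> K" "l \<in> K" for k l
    by metis
  \<comment> \<open>Expands |z|^2 = z * cnj z, so that each pair of frequencies contributes one
    oscillation at their difference.\<close>
  have expand: "complex_of_real (?f t) =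
      (\<Sum>k\<in>K. \<Sum>l\<in>K. c k * cnj (c l) * cis ((\<mu> k - \<mu> l) * t))" for t
  proof -
    have "cis ((\<mu> k - \<mu> l) * t) = cis (\<mu> k * t) * cnj (cis (\<mu> l * t))" for k l
      by (simp add: cis_cnj cis_mult left_diff_distrib)
    then show ?thesis
      unfolding complex_norm_square by (simp add: sum_product mult_ac)
  qed
  have "?f integrable_on {a..b}"
    by (intro integrable_continuous_real continuous_intros)
  then have "((\<lambda>t. complex_of_real (?f t)) has_integral of_real (integral {a..b} ?f)) {a..b}"
    by (intro has_integral_of_real) (simp add: integrable_integral)
  moreover have "((\<lambda>t. complex_of_real (?f t)) has_integral
      (\<Sum>k\<in>K. \<Sum>l\<in>K. c k * cnj (c l) * I k l)) {a..b}"
    unfolding expand by (intro has_integral_sum assms(1) has_integral_mult_right I)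
  ultimately have int: "complex_of_real (integral {a..b} ?f) =
      (\<Sum>k\<in>K. \<Sum>l\<in>K. c k * cnj (c l) * I k l)"
    by (rule has_integral_unique)
  \<comment> \<open>Written as a double sum of the same shape as \<open>int\<close>, so that
    subtraction deletes exactly the terms with \<open>k = l\<close>.\<close>
  have diag: "complex_of_real ?D = (\<Sum>k\<in>K. \<Sum>l\<in>K. if k = l then c k * cnj (c l) * I k l else 0)"
  proof -
    have "complex_of_real ?D = (\<Sum>k\<in>K. c k * cnj (c k) * I k k)"
      using I' by (simp add: sum_distrib_left complex_norm_square mult.commute
          flip: of_real_power)
    then show ?thesis
      using assms(1) by simp
  qed
  have "complex_of_real (integral {a..b} ?f - ?D) =
      (\<Sum>k\<in>K. \<Sum>l\<in>K. if k = l then 0 else c k * cnj (c l) * I k l)"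
    unfolding of_real_diff int diag sum_subtractf[symmetric] by (intro sum.cong refl) simp
  from arg_cong[OF this, of norm] have "\<bar>integral {a..b} ?f - ?D\<bar> =
      norm (\<Sum>k\<in>K. \<Sum>l\<in>K. if k = l then 0 else c k * cnj (c l) * I k l)"
    by (simp only: norm_of_real)
  also have "\<dots> \<le> ?B"
  proof (intro sum_norm_le)
    fix k l assume "k \<in> K" "l \<in> K"
    with I'[OF this] show "norm (if k = l then 0 else c k * cnj (c l) * I k l)
        \<le> cmod (c k) * cmod (c l) * (2 / \<bar>\<mu> k - \<mu> l\<bar>)"
      by (auto simp: norm_mult intro!: mult_left_mono simp del: times_divide_eq_right)
  qed
  finally show ?thesis .
qed

section \<open>Off-diagonal estimates with logarithmic frequencies\<close>

lemma powr_div_ln_diff_le: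
  fixes x y \<sigma> :: real
  assumes "0 < x" "x < y" "1 < \<sigma>"
  shows "y powr -\<sigma> / (ln y - ln x) \<le> (y - x) powr -\<sigma>"
proof -
  \<comment> \<open>This is ln u \<le> u - 1 at u = x / y.\<close>
  have "ln x - ln y \<le> (x - y) / y"
    using assms by (intro ln_diff_le) auto
  then have "(y - x) / y \<le> ln y - ln x"
    using assms by (simp add: field_simps)
  then have "y powr -\<sigma> / (ln y - ln x) \<le> y powr -\<sigma> / ((y - x) / y)"
    using assms by (intro divide_left_mono) auto
  also have "\<dots> = y powr (1 - \<sigma>) / (y - x)"
    using assms by (simp add: powr_diff powr_minus field_simps)
  \<comment> \<open>The exponent \<open>1 - \<sigma>\<close> is negative and y - x < y.\<close>
  also have "\<dots> \<le> (y - x) powr (1 - \<sigma>) / (y - x)"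
    using assms by (intro divide_right_mono powr_mono2') auto
  also have "\<dots> = (y - x) powr -\<sigma>"
    using assms by (simp add: powr_diff powr_minus field_simps)
  finally show ?thesis .
qed

text \<open>A form of the preceding bound symmetric in \<open>x\<close> and \<open>y\<close>: the
  smaller argument's power is enlarged to the sum of both, so a sum over ordered pairs need not be
  split by size. For \<open>x = y\<close> both sides are 0, by \<open>x / 0 = 0\<close> and
  \<open>0 powr z = 0\<close>.\<close>

lemma powr_mult_powr_div_ln_diff_le:
  fixes x y \<sigma> :: real
  assumes "0 < x" "0 < y" "1 < \<sigma>"
  shows "x powr -\<sigma> * y powr -\<sigma> / \<bar>ln x - ln y\<bar> \<le> (x powr -\<sigma> + y powr -\<sigma>) * \<bar>x - y\<bar> powr -\<sigma>"
proof -
  have *: "u powr -\<sigma> * v powr -\<sigma> / \<bar>ln u - ln v\<bar> \<le> (u powr -\<sigma> + v powr -\<sigma>) * \<bar>u - v\<bar> powr -\<sigma>"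
    if "0 < u" "u < v" for u v
  proof -
    have "u powr -\<sigma> * v powr -\<sigma> / \<bar>ln u - ln v\<bar> = u powr -\<sigma> * (v powr -\<sigma> / (ln v - ln u))"
      using that by simp
    also have "\<dots> \<le> (u powr -\<sigma> + v powr -\<sigma>) * (v - u) powr -\<sigma>"
      using that assms(3)
      by (intro mult_mono powr_div_ln_diff_le) (auto intro!: divide_nonneg_nonneg)
    finally show ?thesis
      using that by simp
  qed
  show ?thesis
  proof (cases x y rule: linorder_cases)
    case greater
    then show ?thesis
      using *[of y x] assms by (simp add: mult.commute add.commute abs_minus_commute)
  qed (use * assms in auto)
qed

text \<open>Each positive distance from \<open>k\<close> occurs at most twice, once on either side,
  which gives the factor 2. Distance 0 contributes \<open>0 powr -\<sigma> = 0\<close>.\<close>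

lemma sum_powr_dist_le:
  fixes \<sigma> :: real and K :: "nat set"
  assumes "1 < \<sigma>" "finite K"
  shows "(\<Sum>l\<in>K. \<bar>real k - real l\<bar> powr -\<sigma>) \<le> 2 * (\<Sum>n. real n powr -\<sigma>)"
proof -
  let ?Z = "\<Sum>n. real n powr -\<sigma>"
  have sm: "summable (\<lambda>n. real n powr -\<sigma>)"
    using assms(1) by (simp add: summable_real_powr_iff)
  have "(\<Sum>l\<in>K. \<bar>real k - real l\<bar> powr -\<sigma>) =
      (\<Sum>l\<in>K \<inter> {..k}. real (k - l) powr -\<sigma>) + (\<Sum>l\<in>K - {..k}. real (l - k) powr -\<sigma>)"
    using assms(2) by (subst sum.Int_Diff[of K _ "{..k}"])
      (auto intro!: sum.cong arg_cong2[of _ _ _ _ "(+)"])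
  \<comment> \<open>Truncated subtraction is injective on each side of \<open>k\<close>, so each
    half is a sum over a finite set of distances.\<close>
  also have "(\<Sum>l\<in>K \<inter> {..k}. real (k - l) powr -\<sigma>) =
      (\<Sum>n\<in>(\<lambda>l. k - l) ` (K \<inter> {..k}). real n powr -\<sigma>)"
    by (subst sum.reindex) (auto simp: inj_on_def)
  also have "\<dots> \<le> ?Z"
    using assms(2) by (intro sum_le_suminf sm) auto
  also have "(\<Sum>l\<in>K - {..k}. real (l - k) powr -\<sigma>) =
      (\<Sum>n\<in>(\<lambda>l. l - k) ` (K - {..k}). real n powr -\<sigma>)"
    by (subst sum.reindex) (auto simp: inj_on_def)
  also have "\<dots> \<le> ?Z"
    using assms(2) by (intro sum_le_suminf sm) auto
  finally show ?thesis
    by simp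
qed

text \<open>The symmetric bound splits into two sums that agree after swapping indices. In each, the
  sum over distances is at most \<open>2 * ?Z\<close> and the remaining one at most
  \<open>?Z\<close>, hence the constant 4.\<close>

lemma sum_powr_div_ln_diff_le:
  fixes \<sigma> :: real and K :: "nat set"
  assumes "1 < \<sigma>" "finite K" "0 \<notin> K"
  shows "(\<Sum>k\<in>K. \<Sum>l\<in>K. real k powr -\<sigma> * real l powr -\<sigma> / \<bar>ln (real k) - ln (real l)\<bar>)
           \<le> 4 * (\<Sum>n. real n powr -\<sigma>)\<^sup>2"
proof -
  let ?Z = "\<Sum>n. real n powr -\<sigma>"
  let ?g = "\<lambda>k l. real k powr -\<sigma> * \<bar>real k - real l\<bar> powr -\<sigma>"
  have sm: "summable (\<lambda>n. real n powr -\<sigma>)"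
    using assms(1) by (simp add: summable_real_powr_iff)
  have Z: "0 \<le> ?Z"
    by (intro suminf_nonneg sm) auto
  have "(\<Sum>k\<in>K. \<Sum>l\<in>K. real k powr -\<sigma> * real l powr -\<sigma> / \<bar>ln (real k) - ln (real l)\<bar>)
      \<le> (\<Sum>k\<in>K. \<Sum>l\<in>K. (real k powr -\<sigma> + real l powr -\<sigma>) * \<bar>real k - real l\<bar> powr -\<sigma>)"
    using assms(1,3) by (intro sum_mono powr_mult_powr_div_ln_diff_le) (auto intro: Nat.gr0I)
  also have "\<dots> = (\<Sum>k\<in>K. \<Sum>l\<in>K. ?g k l) + (\<Sum>k\<in>K. \<Sum>l\<in>K. ?g l k)"
    by (simp add: distrib_right sum.distrib abs_minus_commute)
  also have "(\<Sum>k\<in>K. \<Sum>l\<in>K. ?g l k) = (\<Sum>k\<in>K. \<Sum>l\<in>K. ?g k l)"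
    by (rule sum.swap)
  also have "(\<Sum>k\<in>K. \<Sum>l\<in>K. ?g k l) \<le> (\<Sum>k\<in>K. real k powr -\<sigma> * (2 * ?Z))"
    unfolding sum_distrib_left[symmetric]
    by (intro sum_mono mult_left_mono sum_powr_dist_le assms) auto
  also have "\<dots> = (\<Sum>k\<in>K. real k powr -\<sigma>) * (2 * ?Z)"
    by (rule sum_distrib_right[symmetric])
  also have "\<dots> \<le> ?Z * (2 * ?Z)"
    using Z by (intro mult_right_mono sum_le_suminf sm assms) auto
  finally show ?thesis
    by (simp add: power2_eq_square)
qed

section \<open>Mean squares of Dirichlet series with bounded coefficients\<close>

lemma mean_square_dirichlet_series:
  fixes a :: "nat \<Rightarrow> complex" and \<sigma> A p q :: real
  defines "F \<equiv> \<lambda>t k. a k * of_real (real k powr -\<sigma>) * cis (- ln (real k) * t)"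
  assumes "1 < \<sigma>" and A: "\<And>k. cmod (a k) \<le> A" and "p \<le> q"
  shows "\<bar>integral {p..q} (\<lambda>t. (cmod (\<Sum>k. F t k))\<^sup>2)
            - (q - p) * (\<Sum>k. (cmod (a k))\<^sup>2 * real k powr (- 2 * \<sigma>))\<bar>
         \<le> 8 * A\<^sup>2 * (\<Sum>n. real n powr -\<sigma>)\<^sup>2"
proof -
  let ?Z = "\<Sum>n. real n powr -\<sigma>"
  define c where "c k = a k * of_real (real k powr -\<sigma>)" for k
  define P where "P N t = (\<Sum>k<N. F t k)" for N t
  define d where "d k = (cmod (a k))\<^sup>2 * real k powr (- 2 * \<sigma>)" for k
  have F: "F t k = c k * cis (- ln (real k) * t)" for t k
    by (simp add: F_def c_def)
  have A0: "0 \<le> A"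
    using A[of 0] norm_ge_zero order_trans by blast
  have c_le: "cmod (c k) \<le> A * real k powr -\<sigma>" for k
    by (simp add: c_def norm_mult mult_right_mono A)
  have c_sq: "(cmod (c k))\<^sup>2 = d k" for k
    by (simp add: c_def d_def norm_mult power_mult_distrib flip: powr_add)
       (simp add: power2_eq_square flip: powr_add)
  have sm: "summable (\<lambda>n. A * real n powr -\<sigma>)"
    using assms(2) by (intro summable_mult) (simp add: summable_real_powr_iff)
  have "summable (\<lambda>k. A\<^sup>2 * real k powr (- 2 * \<sigma>))"
    using assms(2) by (intro summable_mult) (simp add: summable_real_powr_iff)
  then have smd: "summable d"
    by (rule summable_comparison_test_ev[rotated])
       (auto simp: d_def intro!: always_eventually mult_right_mono power_mono A)

  \<comment> \<open>The majorant \<open>A * real k powr -\<sigma>\<close> does not depend on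
    \<open>t\<close>.\<close>
  have ul: "uniform_limit {p..q} P (\<lambda>t. \<Sum>k. F t k) sequentially"
    unfolding P_def using c_le
    by (intro Weierstrass_m_test[OF _ sm]) (simp add: F norm_mult)
  have contP: "continuous_on {p..q} (P N)" for N
    unfolding P_def F by (intro continuous_intros)
  have cont: "continuous_on {p..q} (\<lambda>t. \<Sum>k. F t k)"
    by (rule uniform_limit_theorem[OF _ ul]) (auto simp: contP)
  \<comment> \<open>Uniform convergence passes to products when the limits are bounded; here
    compactness of the interval supplies the bound.\<close>
  have "bounded ((\<lambda>t. cmod (\<Sum>k. F t k)) ` {p..q})"
    by (intro compact_imp_bounded compact_continuous_image continuous_intros cont) auto
  then have "uniform_limit {p..q} (\<lambda>N t. cmod (P N t) * cmod (P N t))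
      (\<lambda>t. cmod (\<Sum>k. F t k) * cmod (\<Sum>k. F t k)) sequentially"
    by (intro uniform_lim_mult uniform_limit_norm ul)
  then have "uniform_limit {p..q} (\<lambda>N t. (cmod (P N t))\<^sup>2) (\<lambda>t. (cmod (\<Sum>k. F t k))\<^sup>2) sequentially"
    by (simp add: power2_eq_square)
  then obtain I J where IJ: "\<And>N. ((\<lambda>t. (cmod (P N t))\<^sup>2) has_integral I N) {p..q}"
      "((\<lambda>t. (cmod (\<Sum>k. F t k))\<^sup>2) has_integral J) {p..q}" "I \<longlonglongrightarrow> J"
    by (rule uniform_limit_integral) (auto intro!: continuous_intros contP)
  have lim: "(\<lambda>N. \<bar>I N - (q - p) * (\<Sum>k<N. d k)\<bar>) \<longlonglongrightarrow> \<bar>J - (q - p) * (\<Sum>k. d k)\<bar>"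
    by (intro tendsto_intros IJ summable_LIMSEQ smd)
  have "\<bar>I N - (q - p) * (\<Sum>k<N. d k)\<bar> \<le> 8 * A\<^sup>2 * ?Z\<^sup>2" for N
  proof -
    let ?K = "{1..<N}"
    \<comment> \<open>Index 0 has coefficient 0, as \<open>0 powr -\<sigma> = 0\<close>. Once it is
      dropped, the frequencies \<open>- ln (real k)\<close> are pairwise distinct.\<close>
    have drop0: "(\<Sum>k<N. f k) = (\<Sum>k\<in>?K. f k)" if "f 0 = 0" for f :: "nat \<Rightarrow> 'b::comm_monoid_add"
      using that by (intro sum.mono_neutral_right) (auto simp: not_le)
    have P: "P N t = (\<Sum>k\<in>?K. c k * cis (- ln (real k) * t))" for t
      unfolding P_def F by (rule drop0) (simp add: c_def)
    have "\<bar>integral {p..q} (\<lambda>t. (cmod (\<Sum>k\<in>?K. c k * cis (- ln (real k) * t)))\<^sup>2)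
            - (q - p) * (\<Sum>k\<in>?K. (cmod (c k))\<^sup>2)\<bar>
        \<le> (\<Sum>k\<in>?K. \<Sum>l\<in>?K. cmod (c k) * cmod (c l) * (2 / \<bar>- ln (real k) - - ln (real l)\<bar>))"
      by (rule mean_square_exponential_sum) (use assms in \<open>auto simp: inj_on_def\<close>)
    also have "\<dots> \<le> (\<Sum>k\<in>?K. \<Sum>l\<in>?K. (A * real k powr -\<sigma>) * (A * real l powr -\<sigma>) *
        (2 / \<bar>ln (real k) - ln (real l)\<bar>))"
      using A0 by (intro sum_mono mult_mono c_le) (auto simp: abs_minus_commute)
    also have "\<dots> = 2 * A\<^sup>2 * (\<Sum>k\<in>?K. \<Sum>l\<in>?K.
        real k powr -\<sigma> * real l powr -\<sigma> / \<bar>ln (real k) - ln (real l)\<bar>)"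
      by (simp add: sum_distrib_left power2_eq_square mult_ac)
    \<comment> \<open>The 2 comes from the oscillatory integral and the 4 from the double sum;
      together they give the 8 of the claim.\<close>
    also have "\<dots> \<le> 2 * A\<^sup>2 * (4 * ?Z\<^sup>2)"
      using assms(2) by (intro mult_left_mono sum_powr_div_ln_diff_le) auto
    also have "(\<Sum>k\<in>?K. (cmod (c k))\<^sup>2) = (\<Sum>k<N. d k)"
      unfolding c_sq by (rule drop0[symmetric]) (simp add: d_def)
    also have "integral {p..q} (\<lambda>t. (cmod (\<Sum>k\<in>?K. c k * cis (- ln (real k) * t)))\<^sup>2) = I N"
      using IJ(1)[of N] by (auto simp: P)
    finally show ?thesis
      by simp
  qed
  then have "\<bar>J - (q - p) * (\<Sum>k. d k)\<bar> \<le> 8 * A\<^sup>2 * ?Z\<^sup>2"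
    by (intro LIMSEQ_le_const2[OF lim]) auto
  moreover have "integral {p..q} (\<lambda>t. (cmod (\<Sum>k. F t k))\<^sup>2) = J"
    using IJ(2) by (rule integral_unique)
  ultimately show ?thesis
    by (simp add: d_def)
qed

section \<open>The double zeta-function as a single Dirichlet series\<close>

lemma summable_on_powr_nat:
  fixes \<sigma> :: real
  assumes "1 < \<sigma>"
  shows "(\<lambda>n. real n powr -\<sigma>) summable_on S"
proof -
  have "(\<lambda>n. real n powr -\<sigma>) summable_on UNIV"
    by (rule norm_summable_imp_summable_on) (use assms in \<open>simp add: summable_real_powr_iff\<close>)
  then show ?thesis
    by (rule summable_on_subset_banach) auto
qed

lemma norm_inverse_nat_powr:
  "cmod (1 / of_nat n powr s) = real n powr - Re s"
  by (simp add: norm_divide norm_powr_real_powr powr_minus field_simps)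

text \<open>Since (m + n)^(-Re s2) \<le> n^(-Re s2), the double series is dominated by a product of
  two convergent zeta series. Absolute convergence then permits summation along the lines m + n =
  k.\<close>

lemma euler_double_zeta_eq_infsum:
  assumes "Re s1 > 1" "Re s2 > 1"
  shows "euler_double_zeta s1 s2 =
    (\<Sum>\<^sub>\<infinity>k\<in>{2::nat..}. (\<Sum>m=1..k-1. 1 / of_nat m powr s1) * (1 / of_nat k powr s2))"
proof -
  let ?f = "\<lambda>(m, n). 1 / of_nat m powr s1 * (1 / of_nat (m + n) powr s2) :: complex"
  let ?g = "\<lambda>(k, m). 1 / of_nat m powr s1 * (1 / of_nat k powr s2) :: complex"
  let ?h = "\<lambda>(m, n). real m powr - Re s1 * real n powr - Re s2"
  let ?S = "SIGMA k:{2::nat..}. {1..k-1}"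
  have "(\<lambda>x. norm (?h x)) summable_on {1..} \<times> {1..}"
    unfolding Infinite_Sum.abs_summable_on_Sigma_iff
    using summable_on_powr_nat[OF assms(1)] summable_on_powr_nat[OF assms(2)]
    by (auto simp: infsum_cmult_right' abs_mult
        intro!: summable_on_cmult_right summable_on_cmult_left)
  then have "(\<lambda>x. norm (?f x)) summable_on {1..} \<times> {1..}"
  proof (rule Infinite_Sum.abs_summable_on_comparison_test)
    fix x :: "nat \<times> nat" assume "x \<in> {1..} \<times> {1..}"
    moreover obtain m n where "x = (m, n)"
      by (cases x)
    moreover have "norm (?f (m, n)) = real m powr - Re s1 * real (m + n) powr - Re s2"
      by (simp only: prod.case norm_mult norm_inverse_nat_powr)
    ultimately show "norm (?f x) \<le> norm (?h x)"
      using assms by (auto intro!: mult_left_mono powr_mono2')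
  qed
  then have f: "?f summable_on {1..} \<times> {1..}"
    by (rule abs_summable_summable)
  have g: "?g summable_on ?S"
    using f
    by (subst summable_on_reindex_bij_witness[where T = "{1..} \<times> {1..}" and h = ?f and
          i = "\<lambda>(m, n). (m + n, m)" and j = "\<lambda>(k, m). (m, k - m)"]) auto
  have "euler_double_zeta s1 s2 = infsum ?f ({1..} \<times> {1..})"
    \<comment> \<open>Moving the outer factor into the inner sum gives an iterated sum of
      \<open>?f\<close>, which summability merges into one over pairs.\<close>
    unfolding euler_double_zeta_def infsum_cmult_right'[symmetric]
    by (rule infsum_Sigma'_banach[OF f])
  also have "\<dots> = infsum ?g ?S"
    by (rule infsum_reindex_bij_witness[where i = "\<lambda>(k, m). (m, k - m)" and
          j = "\<lambda>(m, n). (m + n, m)"]) auto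
  also have "\<dots> = (\<Sum>\<^sub>\<infinity>k\<in>{2..}. \<Sum>m=1..k-1. 1 / of_nat m powr s1 * (1 / of_nat k powr s2))"
    using infsum_Sigma'_banach[OF g] by simp
  finally show ?thesis
    by (simp only: sum_distrib_right)
qed

text \<open>Links the unordered sums from 2 in the definitions to the ordered series from 0 in the
  mean square estimate.\<close>

lemma infsum_atLeast_eq_suminf:
  fixes f :: "nat \<Rightarrow> 'a::banach"
  assumes "summable (\<lambda>n. norm (f n))" "\<And>n. n < N \<Longrightarrow> f n = 0"
  shows "infsum f {N..} = suminf f"
proof -
  have "infsum f {N..} = infsum f UNIV"
    using assms(2) by (intro infsum_cong_neutral) (auto simp: not_le)
  also have "\<dots> = suminf f"
    using assms(1) summable_norm_cancel[OF assms(1)]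
    by (intro infsumI norm_summable_imp_has_sum summable_sums)
  finally show ?thesis .
qed

section \<open>The mean square of the double zeta-function\<close>

theorem theorem1p1:
  fixes s0 :: complex and \<sigma> :: real
  assumes "Re s0 > 1" and "\<sigma> > 1"
  shows "(\<lambda>T::real.
            complex_of_real (integral {2..T} (\<lambda>t. (cmod (euler_double_zeta s0 (Complex \<sigma> t)))\<^sup>2))
              - euler_double_zeta_sq s0 (complex_of_real (2 * \<sigma>)) * complex_of_real T)
          \<in> O[at_top](\<lambda>_. 1)"
proof -
  define a where "a k = (\<Sum>m=1..k-1. 1 / of_nat m powr s0 :: complex)" for k :: nat
  define A where "A = (\<Sum>m. real m powr - Re s0)"
  define D where "D = (\<Sum>k. (cmod (a k))\<^sup>2 * real k powr (- 2 * \<sigma>))"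
  define C where "C = 8 * A\<^sup>2 * (\<Sum>n. real n powr -\<sigma>)\<^sup>2"
  \<comment> \<open>The sum is empty for \<open>k = 1\<close>, and also for \<open>k = 0\<close>
    because \<open>0 - 1 = 0\<close> on naturals.\<close>
  have a0: "a k = 0" if "k < 2" for k
    using that by (simp add: a_def)
  have A: "cmod (a k) \<le> A" for k
  proof -
    have "cmod (a k) \<le> (\<Sum>m=1..k-1. real m powr - Re s0)"
      unfolding a_def by (intro sum_norm_le) (simp add: norm_inverse_nat_powr del: One_nat_def)
    also have "\<dots> \<le> A"
      unfolding A_def using assms by (intro sum_le_suminf) (auto simp: summable_real_powr_iff)
    finally show ?thesis .
  qed
  have zeta: "euler_double_zeta s0 (Complex \<sigma> t) =
      (\<Sum>k. a k * of_real (real k powr -\<sigma>) * cis (- ln (real k) * t))" for t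
  proof -
    \<comment> \<open>Splits k^(-s) into its modulus and a phase of frequency
      \<open>- ln (real k)\<close>.\<close>
    have powr: "1 / of_nat k powr Complex \<sigma> t = of_real (real k powr -\<sigma>) * cis (- ln (real k) * t)"
      if "k > 0" for k :: nat
    proof -
      have "1 / of_nat k powr Complex \<sigma> t = exp (- (Complex \<sigma> t * of_real (ln (real k))))"
        using that by (simp add: powr_def exp_minus field_simps flip: Ln_of_nat)
      also have "- (Complex \<sigma> t * of_real (ln (real k))) =
          of_real (- \<sigma> * ln (real k)) + \<i> * of_real (- ln (real k) * t)"
        by (simp add: complex_eq_iff)
      also have "exp \<dots> = of_real (real k powr -\<sigma>) * cis (- ln (real k) * t)"
        using that unfolding exp_add cis_conv_exp exp_of_real by (simp add: powr_def)
      finally show ?thesis .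
    qed
    have "summable (\<lambda>k. A * real k powr -\<sigma>)"
      using assms by (intro summable_mult) (simp add: summable_real_powr_iff)
    then have sm: "summable (\<lambda>k. norm (a k * of_real (real k powr -\<sigma>) * cis (- ln (real k) * t)))"
      by (rule summable_comparison_test_ev[rotated])
         (auto simp: norm_mult intro!: always_eventually mult_right_mono A)
    have "euler_double_zeta s0 (Complex \<sigma> t) = (\<Sum>\<^sub>\<infinity>k\<in>{2..}. a k * (1 / of_nat k powr Complex \<sigma> t))"
      using assms by (simp add: euler_double_zeta_eq_infsum a_def)
    also have "\<dots> = (\<Sum>\<^sub>\<infinity>k\<in>{2..}. a k * of_real (real k powr -\<sigma>) * cis (- ln (real k) * t))"
      by (intro infsum_cong) (simp add: powr mult.assoc)
    also have "\<dots> = (\<Sum>k. a k * of_real (real k powr -\<sigma>) * cis (- ln (real k) * t))"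
      by (intro infsum_atLeast_eq_suminf sm) (simp add: a0)
    finally show ?thesis .
  qed
  have zeta_sq: "euler_double_zeta_sq s0 (complex_of_real (2 * \<sigma>)) = of_real D"
  proof -
    have "summable (\<lambda>k. A\<^sup>2 * real k powr (- 2 * \<sigma>))"
      using assms by (intro summable_mult) (simp add: summable_real_powr_iff)
    then have sm: "summable (\<lambda>k. (cmod (a k))\<^sup>2 * real k powr (- 2 * \<sigma>))"
      by (rule summable_comparison_test_ev[rotated])
         (auto intro!: always_eventually mult_right_mono power_mono A)
    have "euler_double_zeta_sq s0 (complex_of_real (2 * \<sigma>)) =
        (\<Sum>\<^sub>\<infinity>k\<in>{2..}. complex_of_real ((cmod (a k))\<^sup>2 * real k powr (- 2 * \<sigma>)))"
      unfolding euler_double_zeta_sq_def a_def[symmetric]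
    proof (intro infsum_cong)
      fix k :: nat
      have "(of_nat k :: complex) powr of_real (2 * \<sigma>) = of_real (real k powr (2 * \<sigma>))"
        using powr_of_real[of "real k" "2 * \<sigma>"] by simp
      then show "complex_of_real ((cmod (a k))\<^sup>2) * (1 / of_nat k powr of_real (2 * \<sigma>)) =
          of_real ((cmod (a k))\<^sup>2 * real k powr (- 2 * \<sigma>))"
        by (simp add: powr_minus field_simps)
    qed
    also have "\<dots> = (\<Sum>k. complex_of_real ((cmod (a k))\<^sup>2 * real k powr (- 2 * \<sigma>)))"
      using sm by (intro infsum_atLeast_eq_suminf) (auto simp: a0 norm_mult norm_power)
    also have "\<dots> = of_real D"
      unfolding D_def by (rule suminf_of_real[OF sm, symmetric])
    finally show ?thesis .
  qed
  \<comment> \<open>The interval has length \<open>T - 2\<close>, so replacing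
    \<open>(T - 2) * D\<close> by \<open>D * T\<close> costs at most
    \<open>2 * \<bar>D\<bar>\<close>.\<close>
  have "norm (complex_of_real (integral {2..T} (\<lambda>t. (cmod (euler_double_zeta s0 (Complex \<sigma> t)))\<^sup>2))
          - euler_double_zeta_sq s0 (complex_of_real (2 * \<sigma>)) * complex_of_real T)
        \<le> C + 2 * \<bar>D\<bar>" if "T \<ge> 2" for T
  proof -
    let ?I = "integral {2..T} (\<lambda>t. (cmod (euler_double_zeta s0 (Complex \<sigma> t)))\<^sup>2)"
    have "\<bar>?I - (T - 2) * D\<bar> \<le> C"
      unfolding zeta D_def C_def
      by (rule mean_square_dirichlet_series[OF assms(2) A that])
    then have "\<bar>?I - D * T\<bar> \<le> C + 2 * \<bar>D\<bar>"
      by (simp add: algebra_simps)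
    then show ?thesis
      by (simp only: zeta_sq norm_of_real flip: of_real_mult of_real_diff)
  qed
  then show ?thesis
    by (intro bigoI[where c = "C + 2 * \<bar>D\<bar>"])
       (auto intro!: eventually_mono[OF eventually_ge_at_top[of 2]])
qed

end
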